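(* Assume $P\in[0,1)$ and $\lim_{x\uparrow 1/P}F(x)=\infty$. Let $\gamma>0$ be fixed, let $\lambda=s-\gamma\sqrt{s}$ (with $s>\gamma^2$), and let $\Omega$ be the solution, with $\lambda+\Omega\in(0,\lambda_P)$, of $$\Omega=(\lambda+\Omega)\,D_F^R(s,\lambda+\Omega).$$ Then $$\lim_{s\to\infty}\frac{\Omega}{\sqrt{s}}=a,$$ where $a$ is the unique positive solution of the equation $$a=\frac{\varphi(\gamma-a)}{\Phi(\gamma-a)}.$$ Furthermore, with $\bar D_F(s,\lambda)=D_F(s,\lambda+\Omega)$ and $\bar D_F^R(s,\lambda)=D_F^R(s,\lambda+\Omega)$, $$\lim_{s\to\infty}\sqrt{s}\,\bar D_F(s,s-\gamma\sqrt{s})=(1+F(1))\frac{\varphi(\gamma-a)}{\Phi(\gamma-a)},\qquad \lim_{s\to\infty}\sqrt{s}\,\bar D_F^R(s,s-\gamma\sqrt{s})=\frac{\varphi(\gamma-a)}{\Phi(\gamma-a)}.$$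
   Context: $\Phi$ and $\varphi$ are the standard normal distribution function and density. $s\ge1$ is an integer (number of servers) and $(p_k)_{k\ge s}$ is a sequence in $[0,1]$ (admission policy). The numbers $p_{s+n}$, $n\ge 0$, do not depend on $s$ (i.e. $p_{s+n}=q_n$ for a fixed sequence $(q_n)_{n\ge0}$ in $[0,1]$), so that the power series $F(x)=\sum_{n=0}^{\infty}p_s\cdots p_{s+n}\,x^{n+1}$ and the number $P=\limsup_{n\to\infty}(p_s\cdots p_{s+n})^{1/(n+1)}\in[0,1]$ do not depend on $s$. The radius of convergence of $F$ is $1/P$ ($=\infty$ if $P=0$). Put $\lambda_P=s/P$ ($=\infty$ if $P=0$). The Erlang B function is $B(s,\lambda)=\dfrac{\lambda^s/s!}{\sum_{k=0}^s\lambda^k/k!}$. For $0<\lambda<\lambda_P$ define $$D_F(s,\lambda)=\frac{1+F(\lambda/s)}{B(s,\lambda)^{-1}+F(\lambda/s)},\qquad D_F^R(s,\lambda)=\frac{1+(1-s/\lambda)F(\lambda/s)}{B(s,\lambda)^{-1}+F(\lambda/s)}.$$ (These are the stationary probabilities that an arriving customer finds all servers occupied, respectively is rejected, in the birth-death queue with birth rates $\lambda$ for $k<s$ and $\lambda p_k$ for $k\ge s$, and death rates $\min(k,s)$.) Under the hypotheses on $P$ and $F$, the equation for $\Omega$ has exactly one solution when $\lambda\in(0,s)$. *)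

theory Defs
  imports "HOL-Probability.Probability"
begin

text \<open>
  The admission policy enters only through \<open>q n = p\<^bsub>s+n\<^esub>\<close>, the probability of admitting a
  customer who finds \<open>s + n\<close> customers present, which does not depend on the number \<open>s\<close> of
  servers. So the product \<open>p\<^sub>s \<cdots> p\<^bsub>s+n\<^esub>\<close> is \<open>\<Prod>i\<le>n. q i\<close>.
\<close>

definition adm_series :: "(nat \<Rightarrow> real) \<Rightarrow> real \<Rightarrow> real" where
  "adm_series q x = (\<Sum>n. (\<Prod>i\<le>n. q i) * x ^ Suc n)"

text \<open>
  The number \<open>P\<close> is kept as an extended real, so that \<open>s / P\<close> is \<open>\<infinity>\<close> when \<open>P = 0\<close> and \<open>s \<ge> 1\<close>.
\<close>

definition adm_limsup :: "(nat \<Rightarrow> real) \<Rightarrow> ereal" where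
  "adm_limsup q = limsup (\<lambda>n. ereal (root (Suc n) (\<Prod>i\<le>n. q i)))"

definition lambda_P :: "(nat \<Rightarrow> real) \<Rightarrow> nat \<Rightarrow> ereal" where
  "lambda_P q s = ereal (real s) / adm_limsup q"

definition erlang_B :: "nat \<Rightarrow> real \<Rightarrow> real" where
  "erlang_B s l = (l ^ s / fact s) / (\<Sum>k\<le>s. l ^ k / fact k)"

definition D_F :: "(nat \<Rightarrow> real) \<Rightarrow> nat \<Rightarrow> real \<Rightarrow> real" where
  "D_F q s l =
     (1 + adm_series q (l / real s)) / (inverse (erlang_B s l) + adm_series q (l / real s))"

definition D_F_R :: "(nat \<Rightarrow> real) \<Rightarrow> nat \<Rightarrow> real \<Rightarrow> real" where
  "D_F_R q s l =
     (1 + (1 - real s / l) * adm_series q (l / real s))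
       / (inverse (erlang_B s l) + adm_series q (l / real s))"

definition Omega :: "(nat \<Rightarrow> real) \<Rightarrow> nat \<Rightarrow> real \<Rightarrow> real" where
  "Omega q s l =
     (THE w. 0 < l + w \<and> ereal (l + w) < lambda_P q s \<and> w = (l + w) * D_F_R q s (l + w))"

definition D_F_bar :: "(nat \<Rightarrow> real) \<Rightarrow> nat \<Rightarrow> real \<Rightarrow> real" where
  "D_F_bar q s l = D_F q s (l + Omega q s l)"

definition D_F_R_bar :: "(nat \<Rightarrow> real) \<Rightarrow> nat \<Rightarrow> real \<Rightarrow> real" where
  "D_F_R_bar q s l = D_F_R q s (l + Omega q s l)"

abbreviation std_normal_cdf :: "real \<Rightarrow> real" where
  "std_normal_cdf \<equiv> cdf std_normal_distribution"

end

theory Submission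
  imports Defs "HOL-Real_Asymp.Real_Asymp"
begin

text \<open>
  Write \<open>\<lambda> = s - \<gamma>\<surd>s\<close> for the offered load and \<open>m = \<lambda> + \<Omega>\<close> for the load including retrials. The
  proof rests on monotonicity in \<open>m\<close>, which reduces the asymptotics of the fixed point \<open>\<Omega>\<close> to
  pointwise asymptotics of \<open>D_F_R\<close>, and on the classical critical scaling of the Erlang B function.

  \<^bold>\<open>Monotonicity.\<close> The equation \<open>\<Omega> = m D_F_R(m)\<close> says that the mean number of busy servers equals
  \<open>\<lambda>\<close>. Let \<open>N\<close> have the stationary weights \<open>m^k/k!\<close> for \<open>k \<le> s\<close> and \<open>m^s/s! \<cdot> p\<^sub>s \<cdots> p\<^bsub>s+n\<^esub> (m/s)^(n+1)\<close>
  at \<open>s+n+1\<close>. Up to a positive factor, \<open>m - \<lambda> - m D_F_R(m)\<close> is the sum of \<open>min(k,s) - \<lambda>\<close> against these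
  weights. Multiplying the sum by \<open>m powr (-\<lambda>)\<close> turns the terms with \<open>k \<le> s\<close> into
  \<open>(k-\<lambda>) m powr (k-\<lambda>) / k!\<close>, and each of these is strictly increasing in \<open>m\<close> unless \<open>k = \<lambda>\<close>, whatever
  the sign of \<open>k - \<lambda>\<close>; the terms beyond \<open>s\<close> do not decrease. This is \<open>tilted_excess\<close>. It is strictly increasing and
  continuous, so a sign change encloses \<open>\<Omega>\<close> (\<open>Omega_enclosure\<close>).

  \<^bold>\<open>Pointwise limit.\<close> Erlang's integral
  \<open>B(s,m)\<^sup>-\<^sup>1 = (m/u) \<integral>\<^sub>0\<^sup>\<infinity> (1 + x/u)^s exp(-(m/u) x) dx\<close> with \<open>u = \<surd>s\<close> and \<open>m = s - \<beta>\<surd>s\<close> has an integrand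
  converging to \<open>exp(\<beta>x - x\<^sup>2/2)\<close>, and dominated convergence gives
  \<open>B\<^sup>-\<^sup>1/\<surd>s \<longrightarrow> \<Phi>(\<beta>)/\<phi>(\<beta>)\<close>. Since \<open>P < 1\<close>, \<open>F\<close> is continuous at \<open>1\<close>; as \<open>m/s \<longrightarrow> 1\<close>, the terms with \<open>F\<close> are
  negligible and \<open>\<surd>s D_F_R(s,m) \<longrightarrow> \<phi>(\<beta>)/\<Phi>(\<beta>)\<close> (\<open>D_F_R_critical_limit\<close>).

  \<^bold>\<open>Conclusion.\<close> At \<open>m = \<lambda> + c\<surd>s = s - (\<gamma>-c)\<surd>s\<close> the sign of \<open>m - \<lambda> - m D_F_R(m)\<close> is, for large \<open>s\<close>, that
  of \<open>c - \<phi>(\<gamma>-c)/\<Phi>(\<gamma>-c)\<close>. That limiting expression changes sign exactly once, at \<open>a\<close>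
  (\<open>normal_balance_point\<close>), for the same reason as in the discrete case: up to a positive factor it is
  the negative of the mean of \<open>x - \<gamma>\<close> under a half-line normal weight, and exponential tilting makes
  that mean cross zero strictly. Hence \<open>\<Omega>/\<surd>s \<longrightarrow> a\<close>, and the other two limits follow from
  \<open>D_F_R = \<Omega>/m\<close> at the fixed point.
\<close>

section \<open>Erlang's integral for the reciprocal of the Erlang B function\<close>

lemma has_bochner_integral_power_exp_Ici:
  fixes m :: real
  assumes "m > 0"
  shows "has_bochner_integral lborel (\<lambda>x. indicator {0..} x *\<^sub>R (x ^ k * exp (- (m * x)))) (fact k / m ^ Suc k)"
proof -
  have base: "has_bochner_integral lborel (\<lambda>x::real. indicator {0..} x *\<^sub>R (x ^ k * exp (- x))) (fact k)"
  proof (rule has_bochner_integral_nn_integral)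
    show "(\<integral>\<^sup>+ x. ennreal (indicator {0..} x *\<^sub>R (x ^ k * exp (- x))) \<partial>lborel) = ennreal (fact k)"
      using nn_intergal_power_times_exp_Ici[of k]
      by (simp add: indicator_mult_ennreal mult.commute)
  qed (auto split: split_indicator)
  have "has_bochner_integral lborel
      (\<lambda>x. indicator {0..} (0 + m * x) *\<^sub>R ((0 + m * x) ^ k * exp (- (0 + m * x)))) (fact k /\<^sub>R \<bar>m\<bar>)"
    using base assms by (subst lborel_has_bochner_integral_real_affine_iff[symmetric]) auto
  from has_bochner_integral_mult_left[OF this, of "1 / m ^ k"] show ?thesis
    using assms
    by (auto elim!: has_bochner_integral_cong[THEN iffD1, rotated -1]
        simp: indicator_def zero_le_mult_iff power_mult_distrib field_simps)
qed

text \<open>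
  Expanding \<open>(1 + x/u)^s\<close> binomially and integrating term by term gives the sum \<open>s!/k! \<cdot> l^(k-s)\<close> that
  is \<open>B(s,l)\<^sup>-\<^sup>1\<close>. The free scale \<open>u\<close> lets the variable be measured in units of \<open>1/\<surd>s\<close> without a
  later substitution.
\<close>

lemma inverse_erlang_B_integral:
  fixes l u :: real
  assumes "l > 0" "u > 0"
  shows "has_bochner_integral lborel
    (\<lambda>x. indicator {0..} x *\<^sub>R ((1 + x / u) ^ s * exp (- (l / u * x)))) (u / l * inverse (erlang_B s l))"
proof -
  let ?c = "\<lambda>j. real (s choose j) / u ^ j"
  have "has_bochner_integral lborel
      (\<lambda>x. \<Sum>j\<le>s. ?c j * (indicator {0..} x *\<^sub>R (x ^ j * exp (- (l / u * x)))))
      (\<Sum>j\<le>s. ?c j * (fact j / (l / u) ^ Suc j))"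
    using assms by (intro has_bochner_integral_sum has_bochner_integral_mult_right
        has_bochner_integral_power_exp_Ici) auto
  also have "(\<lambda>x. \<Sum>j\<le>s. ?c j * (indicator {0..} x *\<^sub>R (x ^ j * exp (- (l / u * x))))) =
      (\<lambda>x. indicator {0..} x *\<^sub>R ((1 + x / u) ^ s * exp (- (l / u * x))))"
  proof
    fix x
    have "(1 + x / u) ^ s = (\<Sum>j\<le>s. ?c j * x ^ j)"
      using binomial_ring[of "x / u" 1 s] by (simp add: add.commute power_divide)
    then show "(\<Sum>j\<le>s. ?c j * (indicator {0..} x *\<^sub>R (x ^ j * exp (- (l / u * x))))) =
      indicator {0..} x *\<^sub>R ((1 + x / u) ^ s * exp (- (l / u * x)))"
      by (simp add: sum_distrib_left sum_distrib_right algebra_simps)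
  qed
  also have "(\<Sum>j\<le>s. ?c j * (fact j / (l / u) ^ Suc j)) = u / l * inverse (erlang_B s l)"
  proof -
    have "(\<Sum>j\<le>s. ?c j * (fact j / (l / u) ^ Suc j)) = (\<Sum>j\<le>s. u / l * (fact s / (fact (s - j) * l ^ j)))"
      using assms by (intro sum.cong) (auto simp: binomial_fact field_simps)
    also have "\<dots> = (\<Sum>k\<le>s. u / l * (fact s / (fact k * l ^ (s - k))))"
      by (subst sum.nat_diff_reindex[symmetric, where n = "Suc s", folded lessThan_Suc_atMost[symmetric]])
         (simp add: lessThan_Suc_atMost)
    also have "\<dots> = (\<Sum>k\<le>s. u / l * (fact s / l ^ s) * (l ^ k / fact k))"
      using assms by (intro sum.cong refl) (auto simp: power_diff field_simps)
    also have "\<dots> = u / l * inverse (erlang_B s l)"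
      unfolding erlang_B_def sum_distrib_left[symmetric] by simp
    finally show ?thesis .
  qed
  finally show ?thesis .
qed

section \<open>The balance equation for the standard normal distribution\<close>

text \<open>
  Reflecting at \<open>\<beta>\<close> moves the lower tail at \<open>\<beta>\<close> to the fixed half-line \<open>x \<ge> 0\<close>. There only the weight
  depends on \<open>\<beta>\<close>, through the exponential tilt \<open>exp(\<beta>x)\<close>.
\<close>

lemma std_normal_cdf_eq_integral:
  "(LBINT x:{0..}. normal_density \<beta> 1 x) = std_normal_cdf \<beta>"
proof -
  have "std_normal_cdf \<beta> = (\<integral>x. indicator {..\<beta>} x \<partial>std_normal_distribution)"
    by (simp add: cdf_def)
  also have "\<dots> = (\<integral>x. std_normal_density x * indicator {..\<beta>} x \<partial>lborel)"
    by (subst integral_density) auto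
  also have "\<dots> = (\<integral>x. std_normal_density (\<beta> + (-1) * x) * indicator {..\<beta>} (\<beta> + (-1) * x) \<partial>lborel)"
    by (subst lborel_integral_real_affine[where c = "-1" and t = \<beta>]) auto
  also have "\<dots> = (LBINT x:{0..}. normal_density \<beta> 1 x)"
    unfolding set_lebesgue_integral_def
    by (intro Bochner_Integration.integral_cong)
       (auto simp: normal_density_def indicator_def power2_commute)
  finally show ?thesis ..
qed

lemma set_integrable_normal_density:
  "A \<in> sets lborel \<Longrightarrow> set_integrable lborel A (normal_density \<beta> 1)"
  unfolding set_integrable_def by (intro integrable_mult_indicator integrable_normal_density) auto

lemma set_integrable_normal_density_linear:
  assumes "A \<in> sets lborel"
  shows "set_integrable lborel A (\<lambda>x. (x - g) * normal_density \<beta> 1 x)"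
proof -
  have "integrable lborel (\<lambda>x. normal_density \<beta> 1 x * x - g * normal_density \<beta> 1 x)"
    using normal_moment_nz_1[of 1 \<beta>] 
    by (intro Bochner_Integration.integrable_diff integrable_mult_right integrable_normal_density)
       (auto simp: has_bochner_integral_iff)
  then show ?thesis
    using assms unfolding set_integrable_def
    by (intro integrable_mult_indicator) (auto simp: algebra_simps)
qed

text \<open>The integrand is the derivative of \<open>- normal_density \<beta> 1\<close>.\<close>

lemma normal_partial_first_moment:
  "(LBINT x:{0..}. (x - \<beta>) * normal_density \<beta> 1 x) = std_normal_density \<beta>"
proof -
  have "(LBINT x=0..\<infinity>. (x - \<beta>) * normal_density \<beta> 1 x) = 0 - (- normal_density \<beta> 1 0)"
  proof (rule interval_integral_FTC_integrable)
    show "((\<lambda>x. - normal_density \<beta> 1 x) has_vector_derivative (x - \<beta>) * normal_density \<beta> 1 x) (at x)" for x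
      unfolding has_real_derivative_iff_has_vector_derivative[symmetric] normal_density_def
      by (auto intro!: derivative_eq_intros simp: power2_eq_square divide_simps)
    show "isCont (\<lambda>x. (x - \<beta>) * normal_density \<beta> 1 x) x" for x
      unfolding normal_density_def by (intro continuous_intros) auto
    show "set_integrable lborel (einterval 0 \<infinity>) (\<lambda>x. (x - \<beta>) * normal_density \<beta> 1 x)"
      by (intro set_integrable_normal_density_linear) auto
    have "isCont (\<lambda>x. - normal_density \<beta> 1 x) 0"
      unfolding normal_density_def by (intro continuous_intros) auto
    then have "((\<lambda>x. - normal_density \<beta> 1 x) \<longlongrightarrow> - normal_density \<beta> 1 0) (at_right 0)"
      by (simp add: isCont_def filterlim_at_split)
    then show "(((\<lambda>x. - normal_density \<beta> 1 x) \<circ> real_of_ereal) \<longlongrightarrow> - normal_density \<beta> 1 0) (at_right 0)"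
      by (simp add: zero_ereal_def ereal_tendsto_simps)
    have "((\<lambda>x. - normal_density \<beta> 1 x) \<longlongrightarrow> 0) at_top"
      unfolding normal_density_def by real_asymp
    then show "(((\<lambda>x. - normal_density \<beta> 1 x) \<circ> real_of_ereal) \<longlongrightarrow> 0) (at_left \<infinity>)"
      by (simp add: ereal_tendsto_simps)
  qed auto
  moreover have "(LBINT x=0..\<infinity>. (x - \<beta>) * normal_density \<beta> 1 x) = (LBINT x:{0..}. (x - \<beta>) * normal_density \<beta> 1 x)"
    unfolding zero_ereal_def interval_integral_to_infinity_eq
    by (intro set_integral_discrete_difference[where X = "{0}"]) auto
  ultimately show ?thesis by (simp add: normal_density_def)
qed


lemma normal_mean_excess:
  "(LBINT x:{0..}. (x - g) * normal_density \<beta> 1 x) = std_normal_density \<beta> - (g - \<beta>) * std_normal_cdf \<beta>"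
proof -
  have "(LBINT x:{0..}. (x - \<beta>) * normal_density \<beta> 1 x - (g - \<beta>) * normal_density \<beta> 1 x)
      = std_normal_density \<beta> - (g - \<beta>) * std_normal_cdf \<beta>"
    by (subst set_integral_diff)
       (auto intro!: set_integrable_normal_density set_integrable_normal_density_linear
          simp: normal_partial_first_moment std_normal_cdf_eq_integral)
  then show ?thesis by (simp add: algebra_simps)
qed

lemma normal_density_tilt:
  "normal_density \<beta>' 1 x = exp ((\<beta>' - \<beta>) * x + (\<beta>\<^sup>2 - \<beta>'\<^sup>2) / 2) * normal_density \<beta> 1 x"
  unfolding normal_density_def
  by (simp add: mult_exp_exp power2_eq_square field_simps)

text \<open>
  By \<open>normal_mean_excess\<close> both sides compare the mean of \<open>x - g\<close> with zero. Passing from \<open>\<beta>\<close> to \<open>\<beta>'\<close>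
  multiplies the weight by an increasing function \<open>k\<close>, and \<open>(x - g) (k x - k g) > 0\<close> for \<open>x \<noteq> g\<close>; so
  the new mean strictly exceeds \<open>k g\<close> times the old one.
\<close>

lemma normal_mean_excess_crossing:
  assumes "\<beta> < \<beta>'"
    and "(g - \<beta>) * std_normal_cdf \<beta> \<le> std_normal_density \<beta>"
  shows "(g - \<beta>') * std_normal_cdf \<beta>' < std_normal_density \<beta>'"
proof -
  define k where "k x = exp ((\<beta>' - \<beta>) * x + (\<beta>\<^sup>2 - \<beta>'\<^sup>2) / 2)" for x
  have k_pos: "k g > 0" by (simp add: k_def)
  define d where "d x = indicator {0..} x *\<^sub>R ((x - g) * normal_density \<beta>' 1 x - k g * ((x - g) * normal_density \<beta> 1 x))" for x
  have d_eq: "d x = indicator {0..} x * ((x - g) * (k x - k g) * normal_density \<beta> 1 x)" for x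
    by (simp add: d_def normal_density_tilt[of \<beta>' x \<beta>] k_def algebra_simps)
  have factor: "0 < (x - g) * (k x - k g)" if "x \<noteq> g" for x
    using that assms(1) by (auto simp: k_def zero_less_mult_iff not_less)
  have d_nonneg: "0 \<le> d x" for x
    using factor[of x] by (cases "x = g") (auto simp: d_eq)
  have int: "set_integrable lborel {0..} (\<lambda>x. (x - g) * normal_density \<beta>' 1 x)"
    "set_integrable lborel {0..} (\<lambda>x. k g * ((x - g) * normal_density \<beta> 1 x))"
    by (auto intro!: set_integrable_normal_density_linear)
  have "integrable lborel d"
    using set_integral_diff(1)[OF int] by (simp add: d_def[abs_def] set_integrable_def)
  have "\<not> (AE x in lborel. d x = 0)"
  proof
    assume "AE x in lborel. d x = 0"
    then have "AE x in lborel. x \<notin> {max g 0 <..<max g 0 + 1}"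
    proof (rule eventually_mono)
      fix x assume "d x = 0"
      then show "x \<notin> {max g 0 <..<max g 0 + 1}"
        using factor[of x] normal_density_pos[of 1 \<beta> x] by (auto simp: d_eq indicator_def)
    qed
    then have "emeasure lborel {max g 0 <..<max g 0 + 1} = 0"
      by (subst (asm) AE_iff_measurable[where N = "{max g 0 <..<max g 0 + 1}"]) auto
    then show False by simp
  qed
  then have "integral\<^sup>L lborel d \<noteq> 0"
    using integral_nonneg_eq_0_iff_AE[OF \<open>integrable lborel d\<close>] d_nonneg by auto
  then have "0 < integral\<^sup>L lborel d"
    using Bochner_Integration.integral_nonneg[of lborel d] d_nonneg by (simp add: order_less_le)
  also have "integral\<^sup>L lborel d = (std_normal_density \<beta>' - (g - \<beta>') * std_normal_cdf \<beta>')
      - k g * (std_normal_density \<beta> - (g - \<beta>) * std_normal_cdf \<beta>)"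
  proof -
    have "integral\<^sup>L lborel d = (LBINT x:{0..}. (x - g) * normal_density \<beta>' 1 x - k g * ((x - g) * normal_density \<beta> 1 x))"
      by (simp add: d_def[abs_def] set_lebesgue_integral_def)
    then show ?thesis using set_integral_diff(2)[OF int] by (simp add: normal_mean_excess)
  qed
  finally have "k g * (std_normal_density \<beta> - (g - \<beta>) * std_normal_cdf \<beta>)
      < std_normal_density \<beta>' - (g - \<beta>') * std_normal_cdf \<beta>'" by simp
  moreover have "0 \<le> k g * (std_normal_density \<beta> - (g - \<beta>) * std_normal_cdf \<beta>)"
    using k_pos assms(2) by (intro mult_nonneg_nonneg) auto
  ultimately show ?thesis by linarith
qed

text \<open>
  The classical Mills bound, from \<open>exp(-x\<^sup>2/2) \<ge> 1 - x\<^sup>2/2\<close>. It is sharp enough to exceed \<open>1/(\<gamma> + t)\<close>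
  (times the density) for large \<open>t\<close>, however small \<open>\<gamma> > 0\<close> is.
\<close>

lemma std_normal_cdf_tail_lower_bound:
  assumes "t > 0"
  shows "(1 / t - 1 / t ^ 3) * std_normal_density t \<le> std_normal_cdf (- t)"
proof -
  have e: "has_bochner_integral lborel
      (\<lambda>x. std_normal_density t * (indicator {0..} x *\<^sub>R (x ^ 0 * exp (- (t * x)))
        - (1 / 2) * (indicator {0..} x *\<^sub>R (x ^ 2 * exp (- (t * x))))))
      (std_normal_density t * (fact 0 / t ^ Suc 0 - (1 / 2) * (fact 2 / t ^ Suc 2)))"
    by (intro has_bochner_integral_mult_right has_bochner_integral_diff
        has_bochner_integral_power_exp_Ici assms)
  have "std_normal_density t * (fact 0 / t ^ Suc 0 - (1 / 2) * (fact 2 / t ^ Suc 2))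
      \<le> (LBINT x:{0..}. normal_density (- t) 1 x)"
    unfolding has_bochner_integral_integral_eq[OF e, symmetric] set_lebesgue_integral_def
  proof (rule integral_mono)
    show "integrable lborel (\<lambda>x. indicator {0..} x *\<^sub>R normal_density (- t) 1 x)"
      using set_integrable_normal_density[of "{0..}" "- t"] by (simp add: set_integrable_def)
    fix x :: real
    have "normal_density (- t) 1 x = std_normal_density t * exp (- (t * x)) * exp (- x\<^sup>2 / 2)"
      unfolding normal_density_def by (simp add: mult_exp_exp power2_eq_square field_simps)
    moreover have "1 - x\<^sup>2 / 2 \<le> exp (- x\<^sup>2 / 2)"
      using exp_ge_add_one_self[of "- x\<^sup>2 / 2"] by simp
    ultimately have "std_normal_density t * exp (- (t * x)) * (1 - x\<^sup>2 / 2) \<le> normal_density (- t) 1 x"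
      by (simp add: mult_left_mono)
    then show "std_normal_density t * (indicator {0..} x *\<^sub>R (x ^ 0 * exp (- (t * x)))
        - (1 / 2) * (indicator {0..} x *\<^sub>R (x ^ 2 * exp (- (t * x)))))
        \<le> indicator {0..} x *\<^sub>R normal_density (- t) 1 x"
      by (auto simp: indicator_def algebra_simps)
  qed (use e in \<open>auto simp: has_bochner_integral_iff\<close>)
  then show ?thesis
    by (simp add: std_normal_cdf_eq_integral mult.commute numeral_3_eq_3 numeral_2_eq_2)
qed

lemma std_normal_cdf_pos: "std_normal_cdf \<beta> > 0"
proof -
  interpret real_distribution std_normal_distribution by (rule real_dist_normal_dist)
  define t where "t = max 2 (- \<beta>)"
  have "t > 1" "- t \<le> \<beta>" by (auto simp: t_def)
  then have "0 < (1 / t - 1 / t ^ 3) * std_normal_density t"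
    using less_1_mult[of t t] by (intro mult_pos_pos normal_density_pos) (auto simp: field_simps power3_eq_cube)
  also have "\<dots> \<le> std_normal_cdf (- t)"
    using \<open>t > 1\<close> by (intro std_normal_cdf_tail_lower_bound) auto
  also have "\<dots> \<le> std_normal_cdf \<beta>"
    using \<open>- t \<le> \<beta>\<close> by (rule cdf_nondecreasing)
  finally show ?thesis .
qed

lemma isCont_std_normal_cdf: "isCont std_normal_cdf x"
proof -
  interpret real_distribution std_normal_distribution by (rule real_dist_normal_dist)
  have "AE y in lborel. y \<noteq> x" by (rule AE_lborel_singleton)
  then have "emeasure std_normal_distribution {x} = 0"
    by (subst emeasure_density) (auto intro!: nn_integral_0_iff_AE[THEN iffD2] simp: indicator_def elim!: eventually_mono)
  then show ?thesis by (simp add: isCont_cdf measure_def)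
qed

lemma isCont_std_normal_density: "isCont std_normal_density x"
  unfolding normal_density_def by (intro continuous_intros) auto

text \<open>
  Existence is the intermediate value theorem between \<open>0\<close> and \<open>\<gamma> + t\<close>, where \<open>t\<close> is chosen so that
  the Mills bound decides the sign. The strict signs on both sides of \<open>a\<close> are the crossing property;
  they contain uniqueness and are what the sandwich for \<open>\<Omega>\<close> uses.
\<close>

lemma normal_balance_point:
  assumes "\<gamma> > 0"
  obtains a where "a > 0" "std_normal_density (\<gamma> - a) = a * std_normal_cdf (\<gamma> - a)"
    "\<And>c. c < a \<Longrightarrow> c * std_normal_cdf (\<gamma> - c) < std_normal_density (\<gamma> - c)"
    "\<And>c. c > a \<Longrightarrow> std_normal_density (\<gamma> - c) < c * std_normal_cdf (\<gamma> - c)"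
proof -
  define f where "f c = c * std_normal_cdf (\<gamma> - c) - std_normal_density (\<gamma> - c)" for c
  \<comment> \<open>The Mills bound at \<open>t\<close> suffices once \<open>\<gamma> t\<^sup>2 \<ge> t + \<gamma>\<close>, which this \<open>t\<close> satisfies.\<close>
  define t where "t = 1 + 1 / \<gamma>"
  have t: "t > 0" "\<gamma> * t = \<gamma> + 1" using assms by (auto simp: t_def field_simps)
  have f0: "f 0 < 0" by (simp add: f_def normal_density_pos)
  have "1 \<le> (\<gamma> + t) * (1 / t - 1 / t ^ 3)"
  proof -
    have "\<gamma> * t * t - t - \<gamma> \<ge> 0" unfolding t(2) using t by (simp add: algebra_simps)
    then show ?thesis using t(1) by (simp add: field_simps power3_eq_cube power2_eq_square)
  qed
  then have "std_normal_density t \<le> (\<gamma> + t) * ((1 / t - 1 / t ^ 3) * std_normal_density t)"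
    using mult_right_mono[of 1 "(\<gamma> + t) * (1 / t - 1 / t ^ 3)" "std_normal_density t"]
    by (simp add: mult.assoc)
  also have "\<dots> \<le> (\<gamma> + t) * std_normal_cdf (- t)"
    using t assms by (intro mult_left_mono std_normal_cdf_tail_lower_bound) auto
  finally have f1: "f (\<gamma> + t) \<ge> 0"
    by (simp add: f_def normal_density_def)
  have "\<exists>a\<ge>0. a \<le> \<gamma> + t \<and> f a = 0"
  proof (rule IVT)
    show "\<forall>x. 0 \<le> x \<and> x \<le> \<gamma> + t \<longrightarrow> isCont f x"
      unfolding f_def
      by (intro allI impI continuous_intros isCont_o2[OF _ isCont_std_normal_cdf]
          isCont_o2[OF _ isCont_std_normal_density])
  qed (use f0 f1 t assms in auto)
  then obtain a where a: "a \<ge> 0" "f a = 0" by blast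
  have "a > 0" using a f0 by (cases "a = 0") auto
  moreover have "c * std_normal_cdf (\<gamma> - c) < std_normal_density (\<gamma> - c)" if "c < a" for c
    using normal_mean_excess_crossing[of "\<gamma> - a" "\<gamma> - c" \<gamma>] that a by (simp add: f_def)
  moreover have "std_normal_density (\<gamma> - c) < c * std_normal_cdf (\<gamma> - c)" if "c > a" for c
    using normal_mean_excess_crossing[of "\<gamma> - c" "\<gamma> - a" \<gamma>] that a by (force simp: f_def)
  ultimately show ?thesis using a that by (simp add: f_def)
qed

section \<open>The Erlang B function under critical load\<close>

text \<open>
  The dominating function for Erlang's integral. The logarithm of the left-hand side is a concave
  function of \<open>x\<close>, close to \<open>-x\<^sup>2/2\<close>; the bound uses its tangent at \<open>x = K\<close>, whose slope is at most
  \<open>-K/2\<close> uniformly in \<open>u \<ge> K\<close>. So \<open>K\<close> can be chosen to defeat any exponential factor \<open>exp(\<beta>x)\<close>.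
\<close>

lemma compound_growth_bound:
  fixes u K x :: real
  assumes "K > 0" "K \<le> u" "x \<ge> 0" "u\<^sup>2 = real s"
  shows "(1 + x / u) ^ s * exp (- (u * x)) \<le> exp (K\<^sup>2 - K / 2 * x)"
proof -
  have u: "u > 0" using assms by simp
  \<comment> \<open>Factoring out the value at \<open>K\<close> makes \<open>1 + y \<le> exp y\<close> act as the tangent inequality there.\<close>
  have "1 + x / u = (1 + K / u) * (1 + (x - K) / (u + K))"
    using u assms by (simp add: divide_simps)
  also have "\<dots> \<le> exp (K / u) * exp ((x - K) / (u + K))"
    using u assms by (intro mult_mono exp_ge_add_one_self) (auto simp: field_simps)
  finally have "(1 + x / u) ^ s \<le> exp (K / u + (x - K) / (u + K)) ^ s"
    using u assms by (intro power_mono) (auto simp: exp_add)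
  also have "\<dots> = exp (u\<^sup>2 * (K / u + (x - K) / (u + K)))"
    using assms by (simp add: exp_of_nat_mult)
  finally have "(1 + x / u) ^ s * exp (- (u * x)) \<le> exp (u\<^sup>2 * (K / u + (x - K) / (u + K)) - u * x)"
    by (simp add: exp_diff exp_minus divide_simps)
  also have "u\<^sup>2 * (K / u + (x - K) / (u + K)) - u * x = - ((x - K) * (u * K / (u + K)))"
    using u assms(1) by (simp add: divide_simps power2_eq_square) (simp add: algebra_simps)
  also have "\<dots> \<le> K\<^sup>2 - K / 2 * x"
  proof -
    have b: "K / 2 \<le> u * K / (u + K)" "u * K / (u + K) \<le> K"
      using u assms by (auto simp: field_simps mult_mono)
    show ?thesis
    proof (cases "x \<ge> K")
      case True
      then have "(x - K) * (K / 2) \<le> (x - K) * (u * K / (u + K))" using b by (intro mult_left_mono) auto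
      moreover have "(x - K) * (K / 2) = K / 2 * x - K\<^sup>2 / 2" by (simp add: field_simps power2_eq_square)
      ultimately show ?thesis using zero_le_power2[of K] by linarith
    next
      case False
      then have "(K - x) * (u * K / (u + K)) \<le> (K - x) * K" using b by (intro mult_left_mono) auto
      moreover have "(K - x) * K = K\<^sup>2 - K * x" by (simp add: algebra_simps power2_eq_square)
      moreover have "0 \<le> K * x" using assms by simp
      ultimately show ?thesis by (simp only: left_diff_distrib)
    qed
  qed
  finally show ?thesis by simp
qed

lemma compound_growth_limit:
  fixes x \<beta> :: real
  assumes "x \<ge> 0"
  shows "(\<lambda>s. (1 + x / sqrt (real s)) ^ s * exp (- ((real s - \<beta> * sqrt (real s)) / sqrt (real s) * x)))
    \<longlonglongrightarrow> exp (\<beta> * x - x\<^sup>2 / 2)"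
proof (cases "x = 0")
  case False
  with assms have "x > 0" by simp
  then show ?thesis by (real_asymp) (simp add: power2_eq_square)
qed simp


text \<open>
  Dominated convergence in Erlang's integral: the limit integrand \<open>exp(\<beta>x - x\<^sup>2/2)\<close> is
  \<open>normal_density \<beta> 1 x\<close> divided by its value at \<open>0\<close>.
\<close>

lemma inverse_erlang_B_critical_limit:
  fixes \<beta> :: real
  shows "(\<lambda>s. inverse (erlang_B s (real s - \<beta> * sqrt (real s))) / sqrt (real s))
    \<longlonglongrightarrow> std_normal_cdf \<beta> / std_normal_density \<beta>"
proof -
  \<comment> \<open>With this \<open>K\<close> the decay rate \<open>K/2\<close> exceeds \<open>\<beta>\<close> by at least \<open>1\<close>. The integrand is replaced by \<open>0\<close> for
    the finitely many \<open>s\<close> with \<open>\<surd>s < K\<close>, where the bound does not apply.\<close>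
  define K where "K = 2 * \<bar>\<beta>\<bar> + 2"
  define f where "f s x = (if K \<le> sqrt (real s) then indicator {0..} x *\<^sub>R
      ((1 + x / sqrt (real s)) ^ s * exp (- ((real s - \<beta> * sqrt (real s)) / sqrt (real s) * x))) else 0)" for s x
  define w where "w x = exp (K\<^sup>2) * (indicator {0..} x *\<^sub>R (x ^ 0 * exp (- (1 * x))))" for x :: real
  have K: "K > 0" "\<beta> < K" by (auto simp: K_def)
  have large: "\<forall>\<^sub>F s in sequentially. K \<le> sqrt (real s)" by real_asymp
  have lim: "(\<lambda>s. \<integral>x. f s x \<partial>lborel) \<longlonglongrightarrow> (\<integral>x. indicator {0..} x *\<^sub>R exp (\<beta> * x - x\<^sup>2 / 2) \<partial>lborel)"
  proof (rule integral_dominated_convergence[where w = w])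
    show "integrable lborel w"
      unfolding w_def using has_bochner_integral_power_exp_Ici[of 1 0]
      by (intro integrable_mult_right) (simp_all add: has_bochner_integral_iff)
    show "AE x in lborel. (\<lambda>s. f s x) \<longlonglongrightarrow> indicator {0..} x *\<^sub>R exp (\<beta> * x - x\<^sup>2 / 2)"
    proof (rule AE_I2)
      fix x :: real
      show "(\<lambda>s. f s x) \<longlonglongrightarrow> indicator {0..} x *\<^sub>R exp (\<beta> * x - x\<^sup>2 / 2)"
      proof (cases "x \<ge> 0")
        case True
        have "(\<lambda>s. f s x) \<longlonglongrightarrow> exp (\<beta> * x - x\<^sup>2 / 2)"
          using True by (intro Lim_transform_eventually[OF compound_growth_limit[OF True, of \<beta>]])
             (use large in \<open>auto elim!: eventually_mono simp: f_def\<close>)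
        then show ?thesis using True by simp
      next
        case False
        then have "f s x = 0" for s by (simp add: f_def)
        with False show ?thesis by simp
      qed
    qed
    show "AE x in lborel. norm (f s x) \<le> w x" for s
    proof (rule AE_I2)
      fix x :: real
      show "norm (f s x) \<le> w x"
      proof (cases "K \<le> sqrt (real s) \<and> x \<ge> 0")
        case True
        then have s: "sqrt (real s) > 0" "x \<ge> 0" using K by linarith+
        have "(real s - \<beta> * sqrt (real s)) / sqrt (real s) = sqrt (real s) - \<beta>"
          using s by (simp add: diff_divide_distrib real_div_sqrt)
        moreover have "exp (- ((sqrt (real s) - \<beta>) * x)) = exp (- (sqrt (real s) * x)) * exp (\<beta> * x)"
          by (simp add: mult_exp_exp algebra_simps)
        ultimately have "f s x = ((1 + x / sqrt (real s)) ^ s * exp (- (sqrt (real s) * x))) * exp (\<beta> * x)"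
          using True by (simp add: f_def)
        also have "\<dots> \<le> exp (K\<^sup>2 - K / 2 * x) * exp (\<beta> * x)"
          using True K by (intro mult_right_mono compound_growth_bound) auto
        also have "\<dots> \<le> exp (K\<^sup>2) * exp (- x)"
        proof -
          have "\<beta> * x \<le> \<bar>\<beta>\<bar> * x" using s by (intro mult_right_mono) auto
          then show ?thesis by (simp add: mult_exp_exp K_def algebra_simps)
        qed
        finally show ?thesis using s by (simp add: w_def f_def)
      qed (auto simp: f_def w_def)
    qed
  qed (auto simp: f_def)
  have "(\<integral>x. indicator {0..} x *\<^sub>R exp (\<beta> * x - x\<^sup>2 / 2) \<partial>lborel)
      = (LBINT x:{0..}. normal_density \<beta> 1 x / std_normal_density \<beta>)"
    unfolding set_lebesgue_integral_def normal_density_def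
    by (simp add: exp_diff[symmetric] power2_eq_square field_simps)
  also have "\<dots> = std_normal_cdf \<beta> / std_normal_density \<beta>"
    by (simp add: std_normal_cdf_eq_integral)
  finally have lim': "(\<lambda>s. \<integral>x. f s x \<partial>lborel) \<longlonglongrightarrow> std_normal_cdf \<beta> / std_normal_density \<beta>"
    using lim by simp
  have "(\<lambda>s. (real s - \<beta> * sqrt (real s)) / real s) \<longlonglongrightarrow> 1" by real_asymp
  from tendsto_mult[OF this lim'] 
  have "(\<lambda>s. (real s - \<beta> * sqrt (real s)) / real s * (\<integral>x. f s x \<partial>lborel))
      \<longlonglongrightarrow> std_normal_cdf \<beta> / std_normal_density \<beta>" by simp
  moreover have "\<forall>\<^sub>F s in sequentially. (real s - \<beta> * sqrt (real s)) / real s * (\<integral>x. f s x \<partial>lborel)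
      = inverse (erlang_B s (real s - \<beta> * sqrt (real s))) / sqrt (real s)"
    using large
  proof eventually_elim
    case (elim s)
    then have r: "sqrt (real s) > 0" "\<beta> < sqrt (real s)" using K by linarith+
    have sq: "real s = sqrt (real s) * sqrt (real s)" by simp
    have "\<beta> * sqrt (real s) < sqrt (real s) * sqrt (real s)"
      using r by (intro mult_strict_right_mono) auto
    then have l: "real s - \<beta> * sqrt (real s) > 0" using sq by linarith
    have "(\<integral>x. f s x \<partial>lborel) = sqrt (real s) / (real s - \<beta> * sqrt (real s))
        * inverse (erlang_B s (real s - \<beta> * sqrt (real s)))"
      using has_bochner_integral_integral_eq[OF inverse_erlang_B_integral[OF l r(1)]] elim
      by (simp add: f_def)
    then have "(real s - \<beta> * sqrt (real s)) / real s * (\<integral>x. f s x \<partial>lborel)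
        = sqrt (real s) / real s * inverse (erlang_B s (real s - \<beta> * sqrt (real s)))"
      using l by simp
    also have "sqrt (real s) / real s = 1 / sqrt (real s)"
      using r(1) real_sqrt_mult_self[of "real s"] by (simp add: divide_simps)
    finally show ?case by simp
  qed
  ultimately show ?thesis by (rule Lim_transform_eventually)
qed


section \<open>The admission series inside its disc of convergence\<close>

text \<open>
  The product \<open>p * x < 1\<close> expresses \<open>x < 1 / p\<close> and needs no separate case for \<open>p = 0\<close>. Any \<open>r\<close>
  strictly between \<open>p\<close> and \<open>1 / x\<close> makes the series eventually smaller than a geometric one of ratio
  \<open>r x < 1\<close>.
\<close>

lemma adm_series_summable:
  assumes q: "\<And>n. 0 \<le> q n" and p: "adm_limsup q = ereal p" and x: "0 \<le> x" "p * x < 1"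
  shows "summable (\<lambda>n. (\<Prod>i\<le>n. q i) * x ^ Suc n)"
proof (cases "x = 0")
  case False
  with x have x_pos: "x > 0" by simp
  have "adm_limsup q < ereal (1 / x)" using x_pos x(2) by (simp add: p field_simps)
  then obtain r where r: "adm_limsup q < ereal r" "r < 1 / x"
    using ereal_dense2[of "adm_limsup q" "ereal (1 / x)"] by auto
  have "\<forall>\<^sub>F n in sequentially. ereal (root (Suc n) (\<Prod>i\<le>n. q i)) < ereal r"
    using r(1) unfolding adm_limsup_def by (rule Limsup_lessD)
  then have ev: "\<forall>\<^sub>F n in sequentially. 0 \<le> r \<and> (\<Prod>i\<le>n. q i) \<le> r ^ Suc n"
  proof eventually_elim
    case (elim n)
    have nonneg: "0 \<le> (\<Prod>i\<le>n. q i)" using q by (intro prod_nonneg) auto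
    then have "0 \<le> root (Suc n) (\<Prod>i\<le>n. q i)" by simp
    moreover have "(\<Prod>i\<le>n. q i) = root (Suc n) (\<Prod>i\<le>n. q i) ^ Suc n"
      using nonneg by (metis real_root_pow_pos2 zero_less_Suc)
    ultimately show ?case using elim by (metis ereal_less(2) less_eq_real_def less_ereal.simps(1) order_le_less_trans power_mono)
  qed
  then obtain n where "0 \<le> r" unfolding eventually_sequentially by blast
  have "summable (\<lambda>n. (r * x) ^ Suc n)"
    using \<open>0 \<le> r\<close> x_pos r(2) by (subst summable_Suc_iff) (auto intro!: summable_geometric simp: field_simps abs_mult)
  moreover have "\<forall>\<^sub>F n in sequentially. norm ((\<Prod>i\<le>n. q i) * x ^ Suc n) \<le> (r * x) ^ Suc n"
    using ev
  proof eventually_elim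
    case (elim n)
    have "(\<Prod>i\<le>n. q i) * x ^ Suc n \<le> r ^ Suc n * x ^ Suc n"
      using elim x_pos by (intro mult_right_mono) auto
    moreover have "0 \<le> (\<Prod>i\<le>n. q i) * x ^ Suc n" using q x_pos by (intro mult_nonneg_nonneg prod_nonneg) auto
    ultimately show ?case by (simp only: real_norm_def abs_of_nonneg power_mult_distrib)
  qed
  ultimately show ?thesis by (rule summable_comparison_test_ev[rotated])
qed simp

lemma adm_series_nonneg:
  assumes "\<And>n. 0 \<le> q n" "adm_limsup q = ereal p" "0 \<le> x" "p * x < 1"
  shows "0 \<le> adm_series q x"
  unfolding adm_series_def
  by (rule suminf_nonneg[OF adm_series_summable[OF assms]])
     (intro mult_nonneg_nonneg prod_nonneg zero_le_power assms)

lemma adm_series_mono: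
  assumes "\<And>n. 0 \<le> q n" "adm_limsup q = ereal p" "0 \<le> p" "0 \<le> x" "x \<le> y" "p * y < 1"
  shows "adm_series q x \<le> adm_series q y"
proof -
  have "p * x \<le> p * y" using assms by (intro mult_left_mono) auto
  with assms show ?thesis
    unfolding adm_series_def
    by (intro suminf_le mult_left_mono power_mono prod_nonneg adm_series_summable[where p = p]) auto
qed

lemma isCont_adm_series:
  assumes q: "\<And>n. 0 \<le> q n" and p: "adm_limsup q = ereal p" "0 \<le> p" and x: "0 \<le> x" "p * x < 1"
  shows "isCont (adm_series q) x"
proof -
  \<comment> \<open>A radius beyond \<open>x\<close> that still satisfies \<open>p * K < 1\<close>, also when \<open>p = 0\<close>.\<close>
  define K where "K = x + (1 - p * x) / (2 * (p + 1))"
  have "x < K" using p x by (simp add: K_def)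
  have "p * K = p * x + p / (p + 1) * ((1 - p * x) / 2)" using p by (simp add: K_def field_simps)
  also have "\<dots> \<le> p * x + 1 * ((1 - p * x) / 2)" using p x by (intro add_left_mono mult_right_mono) auto
  also have "\<dots> = (1 + p * x) / 2" by (simp add: field_simps)
  also have "\<dots> < 1" using x(2) by simp
  finally have "summable (\<lambda>n. (\<Prod>i\<le>n. q i) * K ^ Suc n)"
    using \<open>x < K\<close> x by (intro adm_series_summable[OF q p(1)]) auto
  from summable_mult[OF this, of "inverse K"] have sum: "summable (\<lambda>n. (\<Prod>i\<le>n. q i) * K ^ n)"
    using \<open>x < K\<close> x by (simp add: field_simps)
  have "isCont (\<lambda>y. y * (\<Sum>n. (\<Prod>i\<le>n. q i) * y ^ n)) x"
    using \<open>x < K\<close> x by (intro continuous_intros isCont_powser[OF sum]) auto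
  moreover have "\<forall>\<^sub>F y in nhds x. y * (\<Sum>n. (\<Prod>i\<le>n. q i) * y ^ n) = adm_series q y"
  proof -
    have "\<forall>\<^sub>F y in nhds x. y \<in> {- K<..<K}"
      using \<open>x < K\<close> x by (intro eventually_nhds_in_open) auto
    then show ?thesis
    proof eventually_elim
      case (elim y)
      have "summable (\<lambda>n. (\<Prod>i\<le>n. q i) * y ^ n)"
        using elim by (intro powser_inside[OF sum]) auto
      from suminf_mult[OF this, of y] show ?case
        by (simp add: adm_series_def algebra_simps)
    qed
  qed
  ultimately show ?thesis by (subst isCont_cong[symmetric]) 
qed

lemma less_lambda_P_iff:
  assumes "adm_limsup q = ereal p" "0 \<le> p" "s > 0"
  shows "ereal m < lambda_P q s \<longleftrightarrow> p * (m / real s) < 1"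
  using assms by (cases "p = 0") (simp_all add: lambda_P_def ereal_divide field_simps)

section \<open>Monotonicity and the enclosure of the fixed point\<close>

lemma erlang_B_pos: "m > 0 \<Longrightarrow> erlang_B s m > 0"
  unfolding erlang_B_def by (intro divide_pos_pos sum_pos) auto

text \<open>The carried load of the loss system, offered load times the fraction of customers not blocked.\<close>

lemma erlang_carried_load:
  fixes m :: real
  shows "(\<Sum>k\<le>s. real k * (m ^ k / fact k)) = m * ((\<Sum>k\<le>s. m ^ k / fact k) - m ^ s / fact s)"
proof (induction s)
  case (Suc s)
  have "real (Suc s) * (m ^ Suc s / fact (Suc s)) = m * (m ^ s / fact s)"
    by (simp add: field_simps del: of_nat_Suc)
  then show ?case using Suc by (simp add: algebra_simps del: of_nat_Suc fact_Suc)
qed simp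

text \<open>
  The unnormalised mean of \<open>min(N,s) - l\<close> for the stationary number \<open>N\<close> of customers at load \<open>m\<close>,
  multiplied by \<open>m powr (-l)\<close>. The tilt makes every term monotone in \<open>m\<close>.
\<close>

definition tilted_excess :: "(nat \<Rightarrow> real) \<Rightarrow> nat \<Rightarrow> real \<Rightarrow> real \<Rightarrow> real" where
  "tilted_excess q s l m =
     (\<Sum>k\<le>s. (real k - l) * m powr (real k - l) / fact k)
       + (real s - l) * m powr (real s - l) / fact s * adm_series q (m / real s)"

text \<open>
  The link between the stationary mean and the fixed-point equation: the carried load identity
  expresses the finite sum by \<open>B\<^sup>-\<^sup>1\<close>, and the factor in front of \<open>m - l - m D_F_R(m)\<close> is positive, so
  \<open>tilted_excess\<close> has the sign of the defect in the equation.
\<close>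

lemma tilted_excess_eq:
  assumes "m > 0" "adm_series q (m / real s) \<ge> 0"
  shows "tilted_excess q s l m = m powr (real s - l) / fact s
    * (inverse (erlang_B s m) + adm_series q (m / real s)) * (m - l - m * D_F_R q s m)"
proof -
  define b where "b = inverse (erlang_B s m)"
  define F where "F = adm_series q (m / real s)"
  define S where "S = (\<Sum>k\<le>s. m ^ k / fact k)"
  have "b > 0" using erlang_B_pos[OF assms(1)] by (simp add: b_def)
  then have bF: "b + F > 0" using assms(2) by (simp add: F_def)
  have S: "S = m ^ s / fact s * b"
    using assms(1) by (simp add: b_def erlang_B_def S_def)
  have "(\<Sum>k\<le>s. (real k - l) * m powr (real k - l) / fact k)
      = (\<Sum>k\<le>s. m powr (- l) * (real k * (m ^ k / fact k) - l * (m ^ k / fact k)))"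
    using assms(1) by (intro sum.cong refl) (simp add: powr_diff powr_minus powr_realpow field_simps)
  also have "\<dots> = m powr (- l) * (m * (S - m ^ s / fact s) - l * S)"
    by (simp add: sum_distrib_left[symmetric] sum_subtractf erlang_carried_load S_def del: times_divide_eq_right)
  also have "\<dots> = m powr (real s - l) / fact s * (m * (b - 1) - l * b)"
    using assms(1) unfolding S by (simp add: powr_diff powr_minus powr_realpow field_simps)
  finally have E: "(\<Sum>k\<le>s. (real k - l) * m powr (real k - l) / fact k)
      = m powr (real s - l) / fact s * (m * (b - 1) - l * b)" .
  have "tilted_excess q s l m = m powr (real s - l) / fact s * (m * (b - 1) - l * b + (real s - l) * F)"
    unfolding tilted_excess_def E F_def[symmetric] by (simp add: field_simps)
  also have "m * (b - 1) - l * b + (real s - l) * F = (b + F) * (m - l - m * D_F_R q s m)"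
  proof -
    have "(b + F) * D_F_R q s m = 1 + (1 - real s / m) * F"
      using bF by (simp add: D_F_R_def b_def[symmetric] F_def[symmetric])
    then have "m * ((b + F) * D_F_R q s m) = m + (m - real s) * F"
      using assms(1) by (simp add: field_simps)
    then show ?thesis by (simp add: algebra_simps)
  qed
  finally show ?thesis by (simp add: b_def F_def)
qed

lemma powr_tilt_strict_mono:
  fixes t :: real
  assumes "0 < m" "m < n" "t \<noteq> 0"
  shows "t * m powr t < t * n powr t"
  using assms powr_less_mono2[of t m n] powr_less_mono2_neg[of t m n]
  by (cases "t > 0") auto

text \<open>
  Each term has the form \<open>t * m powr t\<close> with \<open>t = k - l\<close>, up to a constant. The one that is certainly
  strict has \<open>k = 0\<close>, where \<open>t = - l < 0\<close>; for \<open>k = l\<close> the term vanishes.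
\<close>

lemma tilted_excess_strict_mono:
  assumes q: "\<And>n. 0 \<le> q n" and p: "adm_limsup q = ereal p" "0 \<le> p"
    and l: "0 < l" "l < real s" and mn: "0 < m" "m < n" "p * (n / real s) < 1"
  shows "tilted_excess q s l m < tilted_excess q s l n"
proof -
  have term_le: "t * m powr t \<le> t * n powr t" for t
    using powr_tilt_strict_mono[OF mn(1,2), of t] by (cases "t = 0") auto
  have "(\<Sum>k\<le>s. (real k - l) * m powr (real k - l) / fact k)
      < (\<Sum>k\<le>s. (real k - l) * n powr (real k - l) / fact k)"
  proof (rule sum_strict_mono_ex1)
    show "\<exists>k\<in>{..s}. (real k - l) * m powr (real k - l) / fact k < (real k - l) * n powr (real k - l) / fact k"
      using powr_tilt_strict_mono[OF mn(1,2), of "- l"] l by (intro bexI[of _ 0]) auto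
  qed (auto intro!: divide_right_mono term_le)
  moreover have "p * (m / real s) < 1"
  proof -
    have "p * (m / real s) \<le> p * (n / real s)" using p mn by (intro mult_left_mono divide_right_mono) auto
    with mn(3) show ?thesis by simp
  qed
  then have "(real s - l) * m powr (real s - l) / fact s * adm_series q (m / real s)
      \<le> (real s - l) * n powr (real s - l) / fact s * adm_series q (n / real s)"
    using l mn p by (intro mult_mono divide_right_mono term_le adm_series_mono[OF q p]
        adm_series_nonneg[OF q p(1)]) auto
  ultimately show ?thesis by (simp add: tilted_excess_def)
qed

lemma isCont_tilted_excess:
  assumes q: "\<And>n. 0 \<le> q n" and p: "adm_limsup q = ereal p" "0 \<le> p"
    and "0 < m" "0 < s" "p * (m / real s) < 1"
  shows "isCont (tilted_excess q s l) m"
proof -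
  have "isCont (\<lambda>x. adm_series q (x / real s)) m"
    by (rule isCont_o2[OF _ isCont_adm_series[OF q p]])
       (use assms(4-6) in \<open>auto intro!: continuous_intros\<close>)
  then show ?thesis
    unfolding tilted_excess_def using assms(4) by (intro continuous_intros) auto
qed

text \<open>
  A sign change between \<open>m\<close> and \<open>n\<close> yields a root of \<open>tilted_excess\<close>, and strict monotonicity makes it
  the only one on the whole of \<open>(0, \<lambda>\<^sub>P)\<close>. So the definite description in \<open>Omega\<close> denotes this root.
\<close>

lemma Omega_enclosure:
  assumes q: "\<And>n. 0 \<le> q n" and p: "adm_limsup q = ereal p" "0 \<le> p"
    and l: "0 < l" "l < real s"
    and mn: "0 < m" "m < n" "p * (n / real s) < 1"
    and low: "m - l < m * D_F_R q s m" and high: "n * D_F_R q s n < n - l"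
  shows "m < l + Omega q s l" "l + Omega q s l < n"
    "Omega q s l = (l + Omega q s l) * D_F_R q s (l + Omega q s l)"
proof -
  have s: "s > 0" using l by (cases s) auto
  have conv: "p * (x / real s) < 1" if "x \<le> n" for x
  proof -
    have "p * (x / real s) \<le> p * (n / real s)" using p that by (intro mult_left_mono divide_right_mono) auto
    with mn(3) show ?thesis by simp
  qed
  have nonneg: "adm_series q (x / real s) \<ge> 0" if "x > 0" "p * (x / real s) < 1" for x
    using that by (intro adm_series_nonneg[OF q p(1)]) auto
  define C where "C x = x powr (real s - l) / fact s * (inverse (erlang_B s x) + adm_series q (x / real s))" for x
  have C: "C x > 0" if "x > 0" "p * (x / real s) < 1" for x
    using that nonneg[OF that] erlang_B_pos[of x s] unfolding C_def
    by (intro mult_pos_pos divide_pos_pos add_pos_nonneg) auto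
  have eq: "tilted_excess q s l x = C x * (x - l - x * D_F_R q s x)" if "x > 0" "p * (x / real s) < 1" for x
    using that nonneg[OF that] by (simp add: tilted_excess_eq C_def)
  have neg: "tilted_excess q s l m < 0"
    using mn conv[of m] C[of m] low by (simp add: eq mult_pos_neg)
  have pos: "0 < tilted_excess q s l n"
    using mn conv[of n] C[of n] high by (simp add: eq)
  have "\<exists>x\<ge>m. x \<le> n \<and> tilted_excess q s l x = 0"
    using mn neg pos conv s by (intro IVT) (auto intro!: isCont_tilted_excess[OF q p])
  then obtain x where x: "m \<le> x" "x \<le> n" "tilted_excess q s l x = 0" by blast
  then have strict: "m < x" "x < n" using neg pos by (auto simp: order_less_le)
  have x_eq: "x - l = x * D_F_R q s x"
    using x(3) eq[of x] C[of x] conv[OF x(2)] x(1) mn(1) by auto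
  have Omega_eq: "Omega q s l = x - l"
    unfolding Omega_def less_lambda_P_iff[OF p s]
  proof (rule the_equality)
    show "0 < l + (x - l) \<and> p * ((l + (x - l)) / real s) < 1 \<and> x - l = (l + (x - l)) * D_F_R q s (l + (x - l))"
      unfolding add_diff_cancel_left' diff_add_cancel add.commute[of l]
      using mn(1) x(1) conv[OF x(2)] x_eq by (intro conjI) linarith+
    fix w assume w: "0 < l + w \<and> p * ((l + w) / real s) < 1 \<and> w = (l + w) * D_F_R q s (l + w)"
    then have root: "tilted_excess q s l (l + w) = 0" by (subst eq) auto
    have "\<not> l + w < x"
      using tilted_excess_strict_mono[OF q p l, of "l + w" x] w root x(3) conv[OF x(2)] by auto
    moreover have "\<not> x < l + w"
      using tilted_excess_strict_mono[OF q p l, of x "l + w"] w root x(1,3) mn(1) by auto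
    ultimately show "w = x - l" by linarith
  qed
  have shift: "l + Omega q s l = x" by (simp add: Omega_eq)
  show "m < l + Omega q s l" "l + Omega q s l < n"
    "Omega q s l = (l + Omega q s l) * D_F_R q s (l + Omega q s l)"
    unfolding shift using strict x_eq Omega_eq by linarith+
qed

section \<open>Limits at the critical scaling\<close>

text \<open>
  After division by \<open>\<surd>s\<close> only \<open>B\<^sup>-\<^sup>1\<close> survives in the denominator, and the numerator tends to \<open>1\<close>
  because \<open>1 - s/m \<longrightarrow> 0\<close> while \<open>F(m/s)\<close> stays bounded. So the admission policy leaves no trace.
\<close>

lemma D_F_R_critical_limit:
  assumes q: "\<And>n. 0 \<le> q n" and p: "adm_limsup q = ereal p" "0 \<le> p" "p < 1"
  shows "(\<lambda>s. sqrt (real s) * D_F_R q s (real s - \<beta> * sqrt (real s)))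
    \<longlonglongrightarrow> std_normal_density \<beta> / std_normal_cdf \<beta>"
proof -
  let ?m = "\<lambda>s. real s - \<beta> * sqrt (real s)"
  have "(\<lambda>s. ?m s / real s) \<longlonglongrightarrow> 1" by real_asymp
  moreover have "isCont (adm_series q) 1" using p by (intro isCont_adm_series[OF q p(1,2)]) auto
  ultimately have F: "(\<lambda>s. adm_series q (?m s / real s)) \<longlonglongrightarrow> adm_series q 1"
    by (rule isCont_tendsto_compose[rotated])
  have "(\<lambda>s. 1 - real s / ?m s) \<longlonglongrightarrow> 0" by real_asymp
  then have N: "(\<lambda>s. 1 + (1 - real s / ?m s) * adm_series q (?m s / real s)) \<longlonglongrightarrow> 1 + 0 * adm_series q 1"
    by (intro tendsto_intros F)
  have "filterlim (\<lambda>s. sqrt (real s)) at_top sequentially" by real_asymp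
  then have "(\<lambda>s. adm_series q (?m s / real s) / sqrt (real s)) \<longlonglongrightarrow> 0"
    by (intro tendsto_divide_0[OF F] filterlim_at_top_imp_at_infinity)
  from tendsto_add[OF inverse_erlang_B_critical_limit this]
  have D: "(\<lambda>s. inverse (erlang_B s (?m s)) / sqrt (real s) + adm_series q (?m s / real s) / sqrt (real s))
      \<longlonglongrightarrow> std_normal_cdf \<beta> / std_normal_density \<beta>" by simp
  have "(\<lambda>s. (1 + (1 - real s / ?m s) * adm_series q (?m s / real s)) /
      (inverse (erlang_B s (?m s)) / sqrt (real s) + adm_series q (?m s / real s) / sqrt (real s)))
      \<longlonglongrightarrow> std_normal_density \<beta> / std_normal_cdf \<beta>"
    using tendsto_divide[OF N D] std_normal_cdf_pos[of \<beta>] normal_density_pos[of 1 0 \<beta>] by simp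
  then show ?thesis
    by (simp add: D_F_R_def add_divide_distrib[symmetric] mult.commute)
qed

theorem theorem4:
  fixes q :: "nat \<Rightarrow> real" and \<gamma> :: real
  assumes "\<And>n. q n \<in> {0..1}"
    and "adm_limsup q \<in> {0..<1}"
    and "filterlim (adm_series q) at_top
           (if adm_limsup q = 0 then at_top else at_left (1 / real_of_ereal (adm_limsup q)))"
    and "\<gamma> > 0"
  shows "\<exists>a > 0. a = std_normal_density (\<gamma> - a) / std_normal_cdf (\<gamma> - a) \<and>
           (\<forall>b > 0. b = std_normal_density (\<gamma> - b) / std_normal_cdf (\<gamma> - b) \<longrightarrow> b = a) \<and>
           (\<lambda>s. Omega q s (real s - \<gamma> * sqrt (real s)) / sqrt (real s)) \<longlonglongrightarrow> a \<and>
           (\<lambda>s. sqrt (real s) * D_F_bar q s (real s - \<gamma> * sqrt (real s)))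
             \<longlonglongrightarrow> (1 + adm_series q 1) * (std_normal_density (\<gamma> - a) / std_normal_cdf (\<gamma> - a)) \<and>
           (\<lambda>s. sqrt (real s) * D_F_R_bar q s (real s - \<gamma> * sqrt (real s)))
             \<longlonglongrightarrow> std_normal_density (\<gamma> - a) / std_normal_cdf (\<gamma> - a)"
proof -
  have q: "0 \<le> q n" for n using assms(1)[of n] by simp
  obtain p where p: "adm_limsup q = ereal p" "0 \<le> p" "p < 1"
    using assms(2) by (cases "adm_limsup q") (auto simp: zero_ereal_def one_ereal_def)
  obtain a where a: "a > 0" "std_normal_density (\<gamma> - a) = a * std_normal_cdf (\<gamma> - a)"
    "\<And>c. c < a \<Longrightarrow> c * std_normal_cdf (\<gamma> - c) < std_normal_density (\<gamma> - c)"
    "\<And>c. c > a \<Longrightarrow> std_normal_density (\<gamma> - c) < c * std_normal_cdf (\<gamma> - c)"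
    using normal_balance_point[OF assms(4)] by blast
  have a_eq: "std_normal_density (\<gamma> - a) / std_normal_cdf (\<gamma> - a) = a"
    using a(2) std_normal_cdf_pos[of "\<gamma> - a"] by simp
  have unique: "b = a" if "b = std_normal_density (\<gamma> - b) / std_normal_cdf (\<gamma> - b)" for b
  proof (rule ccontr)
    assume "b \<noteq> a"
    moreover have "b * std_normal_cdf (\<gamma> - b) = std_normal_density (\<gamma> - b)"
      using that std_normal_cdf_pos[of "\<gamma> - b"] by (simp add: field_simps)
    ultimately show False using a(3)[of b] a(4)[of b] by linarith
  qed
  define l where "l s = real s - \<gamma> * sqrt (real s)" for s
  \<comment> \<open>The trial load \<open>l + c\<surd>s\<close>, in the form to which the limit with \<open>\<beta> = \<gamma> - c\<close> applies.\<close>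
  define m where "m c s = real s - (\<gamma> - c) * sqrt (real s)" for c s
  have load: "(\<lambda>s. m c s / real s * (sqrt (real s) * D_F_R q s (m c s)))
      \<longlonglongrightarrow> std_normal_density (\<gamma> - c) / std_normal_cdf (\<gamma> - c)" for c
  proof -
    have "(\<lambda>s. m c s / real s) \<longlonglongrightarrow> 1" unfolding m_def by real_asymp
    from tendsto_mult[OF this D_F_R_critical_limit[OF q p, of "\<gamma> - c"]] show ?thesis by (simp add: m_def)
  qed
  have scale: "m c s / real s * (sqrt (real s) * D_F_R q s (m c s)) = m c s * D_F_R q s (m c s) / sqrt (real s)" for c s
    using real_div_sqrt[of "real s"] by (cases "s = 0") (auto simp: field_simps)
  have shift: "m c s - l s = c * sqrt (real s)" for c s by (simp add: m_def l_def algebra_simps)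
  have enclosure: "\<forall>\<^sub>F s in sequentially. m c s < l s + Omega q s (l s) \<and> l s + Omega q s (l s) < m d s
      \<and> Omega q s (l s) = (l s + Omega q s (l s)) * D_F_R q s (l s + Omega q s (l s))"
    if cd: "c < a" "a < d" for c d
  proof -
    have "c < std_normal_density (\<gamma> - c) / std_normal_cdf (\<gamma> - c)"
      using a(3)[OF cd(1)] std_normal_cdf_pos[of "\<gamma> - c"] by (simp add: field_simps)
    note low = order_tendstoD(1)[OF load this]
    have "std_normal_density (\<gamma> - d) / std_normal_cdf (\<gamma> - d) < d"
      using a(4)[OF cd(2)] std_normal_cdf_pos[of "\<gamma> - d"] by (simp add: field_simps)
    note high = order_tendstoD(2)[OF load this]
    have "(\<lambda>s. p * (m d s / real s)) \<longlonglongrightarrow> p" unfolding m_def by real_asymp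
    note conv = order_tendstoD(2)[OF this p(3)]
    have "\<forall>\<^sub>F s in sequentially. 0 < l s" unfolding l_def by real_asymp
    moreover have "\<forall>\<^sub>F s in sequentially. 0 < m c s" unfolding m_def by real_asymp
    ultimately show ?thesis using low high conv eventually_gt_at_top[of 0]
    proof eventually_elim
      case (elim s)
      have r: "sqrt (real s) > 0" using elim by simp
      have "c * sqrt (real s) < d * sqrt (real s)" using cd r by (intro mult_strict_right_mono) auto
      then have cd_m: "m c s < m d s" using shift[of c s] shift[of d s] by linarith
      have ls: "l s < real s" using r assms(4) by (simp add: l_def)
      have "c < m c s * D_F_R q s (m c s) / sqrt (real s)" using elim(3) by (simp only: scale)
      then have low: "m c s - l s < m c s * D_F_R q s (m c s)"
        using r by (simp only: shift pos_less_divide_eq)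
      have "m d s * D_F_R q s (m d s) / sqrt (real s) < d" using elim(4) by (simp only: scale)
      then have high: "m d s * D_F_R q s (m d s) < m d s - l s"
        using r by (simp only: shift pos_divide_less_eq)
      show ?case
        by (intro conjI Omega_enclosure[OF q p(1,2) elim(1) ls elim(2) cd_m elim(5) low high])
    qed
  qed
  have W: "(\<lambda>s. Omega q s (l s) / sqrt (real s)) \<longlonglongrightarrow> a"
  proof (rule order_tendstoI)
    fix c assume "c < a"
    then have "\<forall>\<^sub>F s in sequentially. m c s < l s + Omega q s (l s)"
      by (intro eventually_mono[OF enclosure[of c "a + 1"]]) (assumption, simp, blast)
    then show "\<forall>\<^sub>F s in sequentially. c < Omega q s (l s) / sqrt (real s)"
      using eventually_gt_at_top[of 0]
    proof eventually_elim
      case (elim s)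
      then show ?case using shift[of c s] by (simp add: pos_less_divide_eq)
    qed
  next
    fix d assume "a < d"
    then have "\<forall>\<^sub>F s in sequentially. l s + Omega q s (l s) < m d s"
      by (intro eventually_mono[OF enclosure[of "a - 1" d]]) (simp, assumption, blast)
    then show "\<forall>\<^sub>F s in sequentially. Omega q s (l s) / sqrt (real s) < d"
      using eventually_gt_at_top[of 0]
    proof eventually_elim
      case (elim s)
      then show ?case using shift[of d s] by (simp add: pos_divide_less_eq)
    qed
  qed
  define \<mu> where "\<mu> s = l s + Omega q s (l s)" for s
  have \<mu>1: "(\<lambda>s. \<mu> s / real s) \<longlonglongrightarrow> 1"
  proof -
    have "(\<lambda>s. l s / real s) \<longlonglongrightarrow> 1" unfolding l_def by real_asymp
    moreover have "(\<lambda>s. 1 / sqrt (real s)) \<longlonglongrightarrow> 0" by real_asymp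
    ultimately have "(\<lambda>s. l s / real s + Omega q s (l s) / sqrt (real s) * (1 / sqrt (real s))) \<longlonglongrightarrow> 1 + a * 0"
      by (intro tendsto_intros W)
    then show ?thesis by (simp add: \<mu>_def add_divide_distrib)
  qed
  have sub1: "a - 1 < a" and add1: "a < a + 1" by simp_all
  have R: "(\<lambda>s. sqrt (real s) * D_F_R q s (\<mu> s)) \<longlonglongrightarrow> a"
  proof (rule Lim_transform_eventually)
    show "(\<lambda>s. Omega q s (l s) / sqrt (real s) / (\<mu> s / real s)) \<longlonglongrightarrow> a"
      using tendsto_divide[OF W \<mu>1] by simp
    show "\<forall>\<^sub>F s in sequentially. Omega q s (l s) / sqrt (real s) / (\<mu> s / real s) = sqrt (real s) * D_F_R q s (\<mu> s)"
      using enclosure[OF sub1 add1] order_tendstoD(1)[OF \<mu>1 zero_less_one]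
        eventually_gt_at_top[of 0]
    proof eventually_elim
      case (elim s)
      then have "Omega q s (l s) = \<mu> s * D_F_R q s (\<mu> s)" unfolding \<mu>_def by blast
      moreover have "\<mu> s \<noteq> 0" using elim(2) by auto
      moreover have "real s / sqrt (real s) = sqrt (real s)" by (rule real_div_sqrt) simp
      moreover have "D_F_R q s (\<mu> s) * real s / sqrt (real s) = real s / sqrt (real s) * D_F_R q s (\<mu> s)" by simp
      ultimately show ?case by simp
    qed
  qed
  have F: "(\<lambda>s. adm_series q (\<mu> s / real s)) \<longlonglongrightarrow> adm_series q 1"
    by (rule isCont_tendsto_compose[OF isCont_adm_series[OF q p(1,2)] \<mu>1]) (use p(3) in simp_all)
  have N: "(\<lambda>s. 1 + (1 - real s / \<mu> s) * adm_series q (\<mu> s / real s)) \<longlonglongrightarrow> 1"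
  proof -
    have "(\<lambda>s. 1 + (1 - 1 / (\<mu> s / real s)) * adm_series q (\<mu> s / real s)) \<longlonglongrightarrow> 1 + (1 - 1 / 1) * adm_series q 1"
      by (intro tendsto_intros \<mu>1 F) simp
    then show ?thesis by simp
  qed
  \<comment> \<open>\<open>D_F\<close> and \<open>D_F_R\<close> share their denominator, so their ratio is that of the numerators.\<close>
  have D: "(\<lambda>s. sqrt (real s) * D_F q s (\<mu> s)) \<longlonglongrightarrow> (1 + adm_series q 1) * a"
  proof (rule Lim_transform_eventually)
    show "(\<lambda>s. (1 + adm_series q (\<mu> s / real s)) * (sqrt (real s) * D_F_R q s (\<mu> s))
        / (1 + (1 - real s / \<mu> s) * adm_series q (\<mu> s / real s))) \<longlonglongrightarrow> (1 + adm_series q 1) * a"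
      using tendsto_divide[OF tendsto_mult[OF tendsto_add[OF tendsto_const F] R] N] by simp
    show "\<forall>\<^sub>F s in sequentially. (1 + adm_series q (\<mu> s / real s)) * (sqrt (real s) * D_F_R q s (\<mu> s))
        / (1 + (1 - real s / \<mu> s) * adm_series q (\<mu> s / real s)) = sqrt (real s) * D_F q s (\<mu> s)"
      using order_tendstoD(1)[OF N zero_less_one]
      by eventually_elim (simp add: D_F_def D_F_R_def)
  qed
  show ?thesis
    using a(1) a_eq unique W D R
    by (intro exI[of _ a]) (auto simp: D_F_bar_def D_F_R_bar_def l_def \<mu>_def)
qed

end
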